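(* Let $E$ be a Banach space, $U\subset E$ open, $S$ a $C^1$ submanifold in $U$, and $f:U\to(-\infty,\infty)$ a $C^1$ nonlinear functional. If $x_0\in S$ is a critical point of $f$ under the constraint $S$, then $$N(f'(x_0))\supset T_{x_0}S.$$
   Context: $N(\cdot)$ denotes kernel. $E=A\oplus B$ means $A,B$ are closed subspaces with $A+B=E$, $A\cap B=\{0\}$. $C^1$ submanifold: a subset $S\subset E$ is a $C^1$ submanifold if for each $p\in S$ there are a closed complemented subspace $E_0\subset E$, an open neighborhood $W$ of $p$ in $E$, and a $C^1$ diffeomorphism $\varphi:W\to\varphi(W)$ onto an open subset of $E$, such that $\varphi(S\cap W)$ is an open set in $E_0$. The tangent space is $T_xS=\{\dot c(0): c \text{ a } C^1\text{-curve},\ c(t)\in S,\ c(0)=x\}$. Critical point under the constraint $S$: for $x_0\in S$ there exist a neighborhood $U_0$ of $x_0$ in $E$ (contained in $U$), a closed subspace $E_*$ with $T_{x_0}S\oplus E_*=E$, and a $C^1$ diffeomorphism $\varphi$ from $U_0$ onto the open set $\varphi(U_0)$, such that $V_0=\varphi(S\cap U_0)$ is an open set in $T_{x_0}S$, $\varphi'(x_0)=I_E$, and $\varphi'(x)T_xS=T_{x_0}S$ for $x\in S\cap U_0$. The point $x_0$ is called a critical point of $f$ under the constraint $S$ if $\varphi(x_0)$ is a critical point of $f\circ\varphi^{-1}:V_0\to(-\infty,\infty)$, i.e. $(f\circ\varphi^{-1})'(\varphi(x_0))=0$ in $B(T_{x_0}S,(-\infty,\infty))$, the space of bounded linear functionals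 on $T_{x_0}S$. *)

theory Defs
  imports "HOL-Analysis.Analysis"
begin

text \<open>Frechet \<open>C\<^sup>1\<close> maps: the derivative is continuous for the operator norm. Only used on open \<open>W\<close>.\<close>

definition C1_on :: "'a::real_normed_vector set \<Rightarrow> ('a \<Rightarrow> 'b::real_normed_vector) \<Rightarrow> bool" where
  "C1_on W f \<longleftrightarrow>
    (\<exists>f' :: 'a \<Rightarrow> 'a \<Rightarrow>\<^sub>L 'b.
      (\<forall>x\<in>W. (f has_derivative blinfun_apply (f' x)) (at x)) \<and> continuous_on W f')"

definition C1_diffeo_on :: "'a::real_normed_vector set \<Rightarrow> ('a \<Rightarrow> 'b::real_normed_vector) \<Rightarrow> bool" where
  "C1_diffeo_on W \<phi> \<longleftrightarrow>
    open W \<and> open (\<phi> ` W) \<and> inj_on \<phi> W \<and> C1_on W \<phi> \<and> C1_on (\<phi> ` W) (inv_into W \<phi>)"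

definition closed_direct_sum :: "'a::real_normed_vector set \<Rightarrow> 'a set \<Rightarrow> bool" where
  "closed_direct_sum A B \<longleftrightarrow>
    subspace A \<and> closed A \<and> subspace B \<and> closed B \<and>
    {a + b | a b. a \<in> A \<and> b \<in> B} = UNIV \<and> A \<inter> B = {0}"

definition C1_submanifold :: "'a::real_normed_vector set \<Rightarrow> bool" where
  "C1_submanifold S \<longleftrightarrow>
    (\<forall>p\<in>S. \<exists>E0 W (\<phi> :: 'a \<Rightarrow> 'a).
      (\<exists>F. closed_direct_sum E0 F) \<and> p \<in> W \<and> C1_diffeo_on W \<phi> \<and>
      openin (top_of_set E0) (\<phi> ` (S \<inter> W)))"

text \<open>A curve in \<open>S\<close> through \<open>x\<close> need only be defined on some interval around \<open>0\<close>.\<close>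

definition tangent_space :: "'a::real_normed_vector set \<Rightarrow> 'a \<Rightarrow> 'a set" where
  "tangent_space S x =
    {vector_derivative c (at 0) | c. \<exists>\<epsilon>>0. c C1_differentiable_on {-\<epsilon><..<\<epsilon>} \<and>
      c ` {-\<epsilon><..<\<epsilon>} \<subseteq> S \<and> c 0 = x}"

definition tangent_chart ::
    "'a::real_normed_vector set \<Rightarrow> 'a set \<Rightarrow> 'a \<Rightarrow> 'a set \<Rightarrow> ('a \<Rightarrow> 'a) \<Rightarrow> bool" where
  "tangent_chart U S x0 U0 \<phi> \<longleftrightarrow>
    x0 \<in> U0 \<and> U0 \<subseteq> U \<and> (\<exists>F. closed_direct_sum (tangent_space S x0) F) \<and>
    C1_diffeo_on U0 \<phi> \<and>
    openin (top_of_set (tangent_space S x0)) (\<phi> ` (S \<inter> U0)) \<and>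
    frechet_derivative \<phi> (at x0) = (\<lambda>h. h) \<and>
    (\<forall>x \<in> S \<inter> U0. frechet_derivative \<phi> (at x) ` tangent_space S x = tangent_space S x0)"

text \<open>
  The local representative \<open>f \<circ> \<phi>\<^sup>-\<^sup>1\<close> lives on \<open>V0 = \<phi> ` (S \<inter> U0)\<close>, an open subset of
  \<open>T = tangent_space S x0\<close>. Its derivative at \<open>\<phi> x0\<close> is therefore taken within \<open>V0\<close>, where
  only increments in \<open>T\<close> enter: having the zero map as derivative within \<open>V0\<close> says that the
  derivative, as a bounded functional on \<open>T\<close>, is zero.
\<close>

definition critical_under_constraint ::
    "'a::real_normed_vector set \<Rightarrow> 'a set \<Rightarrow> ('a \<Rightarrow> real) \<Rightarrow> 'a \<Rightarrow> bool" where
  "critical_under_constraint U S f x0 \<longleftrightarrow>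
    x0 \<in> S \<and>
    (\<exists>U0 \<phi>. tangent_chart U S x0 U0 \<phi> \<and>
      ((f \<circ> inv_into U0 \<phi>) has_derivative (\<lambda>h. 0)) (at (\<phi> x0) within \<phi> ` (S \<inter> U0)))"

end

theory Submission
  imports Defs
begin

text \<open>
  Let \<open>v = c'(0)\<close> for a curve \<open>c\<close> in \<open>S\<close> through \<open>x\<^sub>0\<close>. Near \<open>0\<close> one has
  \<open>f \<circ> c = (f \<circ> \<phi>\<^sup>-\<^sup>1) \<circ> (\<phi> \<circ> c)\<close> with \<open>\<phi> \<circ> c\<close> staying in \<open>\<phi>(S \<inter> U\<^sub>0)\<close>, so criticality gives
  \<open>(f \<circ> c)'(0) = 0\<close>, while the chain rule gives \<open>(f \<circ> c)'(0) = f'(x\<^sub>0) v\<close>.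
\<close>

lemma C1_on_imp_differentiable:
  assumes "C1_on W f" and "x \<in> W"
  shows "f differentiable (at x)"
  using assms unfolding C1_on_def differentiable_def by blast

text \<open>Continuity of the curve lets its parameter interval be cut down to the open preimage of
  \<open>W\<close>. The resulting \<open>J\<close> need not be an interval; an open set around 0 is
  enough, since only the derivative at 0 matters.\<close>

lemma tangent_spaceE:
  assumes "v \<in> tangent_space S x" and "open W" and "x \<in> W"
  obtains c :: "real \<Rightarrow> 'a::real_normed_vector" and J
    where "open J" "0 \<in> J" "c ` J \<subseteq> S \<inter> W" "c 0 = x" "(c has_vector_derivative v) (at 0)"
proof -
  obtain c and \<epsilon> :: real where \<epsilon>: "\<epsilon> > 0" and v: "v = vector_derivative c (at 0)"
    and C1: "c C1_differentiable_on {-\<epsilon><..<\<epsilon>}" and S: "c ` {-\<epsilon><..<\<epsilon>} \<subseteq> S" and c0: "c 0 = x"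
    using assms(1) unfolding tangent_space_def by blast
  have "continuous_on {-\<epsilon><..<\<epsilon>} c"
    using C1 by (rule C1_differentiable_imp_continuous_on)
  then have "open ({-\<epsilon><..<\<epsilon>} \<inter> c -` W)"
    using \<open>open W\<close> by (intro continuous_open_preimage) auto
  moreover have "(c has_vector_derivative v) (at 0)"
    using C1 \<epsilon> v by (simp add: C1_differentiable_on_eq vector_derivative_works)
  moreover have "0 \<in> {-\<epsilon><..<\<epsilon>} \<inter> c -` W"
    using \<epsilon> c0 \<open>x \<in> W\<close> by simp
  moreover have "c ` ({-\<epsilon><..<\<epsilon>} \<inter> c -` W) \<subseteq> S \<inter> W"
    using S by auto
  ultimately show thesis
    using that c0 by blast
qed

theorem theorem4p3:
  fixes U S :: "'a::banach set" and f :: "'a \<Rightarrow> real" and x0 :: 'a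
  assumes "open U"
    and "S \<subseteq> U" and "C1_submanifold S"
    and "C1_on U f"
    and "x0 \<in> S" and "critical_under_constraint U S f x0"
  shows "{h. frechet_derivative f (at x0) h = 0} \<supseteq> tangent_space S x0"
proof
  fix v assume v: "v \<in> tangent_space S x0"
  obtain U0 \<phi> where chart: "tangent_chart U S x0 U0 \<phi>"
    and crit: "((f \<circ> inv_into U0 \<phi>) has_derivative (\<lambda>h. 0)) (at (\<phi> x0) within \<phi> ` (S \<inter> U0))"
    using assms(6) unfolding critical_under_constraint_def by blast
  have "open U0" "x0 \<in> U0" "inj_on \<phi> U0" "C1_on U0 \<phi>"
    using chart unfolding tangent_chart_def C1_diffeo_on_def by auto
  obtain c J where J: "open J" "0 \<in> J" and cJ: "c ` J \<subseteq> S \<inter> U0" and c0: "c 0 = x0"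
    and "(c has_vector_derivative v) (at 0)"
    using tangent_spaceE[OF v \<open>open U0\<close> \<open>x0 \<in> U0\<close>] by blast
  then have dc: "(c has_derivative (\<lambda>t. t *\<^sub>R v)) (at 0)"
    by (simp add: has_vector_derivative_def)
  have "(f has_derivative frechet_derivative f (at x0)) (at (c 0))"
    using C1_on_imp_differentiable[OF assms(4)] assms(2,5)
    by (auto simp: c0 simp flip: frechet_derivative_works)
  then have 1: "(f \<circ> c has_derivative frechet_derivative f (at x0) \<circ> (\<lambda>t. t *\<^sub>R v)) (at 0)"
    by (rule diff_chain_at[OF dc])
  have "(\<phi> has_derivative frechet_derivative \<phi> (at x0)) (at (c 0))"
    using C1_on_imp_differentiable[OF \<open>C1_on U0 \<phi>\<close> \<open>x0 \<in> U0\<close>]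
    by (simp add: c0 flip: frechet_derivative_works)
  from diff_chain_at[OF dc this]
  have "(\<phi> \<circ> c has_derivative frechet_derivative \<phi> (at x0) \<circ> (\<lambda>t. t *\<^sub>R v)) (at 0 within J)"
    by (rule has_derivative_at_withinI)
  moreover have "((f \<circ> inv_into U0 \<phi>) has_derivative (\<lambda>h. 0)) (at ((\<phi> \<circ> c) 0) within (\<phi> \<circ> c) ` J)"
  proof -
    have "(\<phi> \<circ> c) ` J \<subseteq> \<phi> ` (S \<inter> U0)"
      using cJ by auto
    from has_derivative_subset[OF crit this] show ?thesis
      by (simp add: c0)
  qed
  ultimately have "((f \<circ> inv_into U0 \<phi>) \<circ> (\<phi> \<circ> c) has_derivative
      (\<lambda>h. 0) \<circ> (frechet_derivative \<phi> (at x0) \<circ> (\<lambda>t. t *\<^sub>R v))) (at 0 within J)"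
    by (rule diff_chain_within)
  \<comment> \<open>The outer derivative is zero, so the composite is zero too; openness of
    \<open>J\<close> turns the derivative within \<open>J\<close> into a full one.\<close>
  then have "((f \<circ> inv_into U0 \<phi>) \<circ> (\<phi> \<circ> c) has_derivative (\<lambda>t. 0)) (at 0)"
    by (simp only: at_within_open[OF J(2,1)] o_def)
  then have "(f \<circ> c has_derivative (\<lambda>t. 0)) (at 0)"
    using J
  proof (rule has_derivative_transform_within_open)
    fix t assume "t \<in> J"
    then show "((f \<circ> inv_into U0 \<phi>) \<circ> (\<phi> \<circ> c)) t = (f \<circ> c) t"
      using cJ \<open>inj_on \<phi> U0\<close> by (auto simp: inv_into_f_f)
  qed
  \<comment> \<open>Both derivatives of \<open>f \<circ> c\<close> at 0 are maps of the increment
    \<open>t\<close>; taking \<open>t = 1\<close> recovers \<open>v\<close> itself.\<close>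
  from fun_cong[OF has_derivative_unique[OF 1 this], of 1]
  show "v \<in> {h. frechet_derivative f (at x0) h = 0}"
    by simp
qed

end
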